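(* Let $H=\begin{pmatrix}0&h\\ h^\dagger&0\end{pmatrix}$ be the Bogoliubov–de Gennes Hamiltonian of a superconductor in symmetry class DIII, written in the eigenbasis of its chiral symmetry $C=-iTP$ (so that $C=\tau_z$), with time-reversal symmetry $T$ and particle-hole symmetry $P$. Let $q,Q,m,M$ and $$\Xi=\frac{\mathbb 1+C}{2}\,MQM^\dagger Q+\frac{\mathbb 1-C}{2}\,M^\dagger QMQ$$ be as defined in the context. Then $TCT^{-1}=-C$, $TMT^{-1}=M^\dagger$ and $TQT^{-1}=Q$, and consequently $$T\,\Xi\,T^{-1}=\Xi ,$$ so that the eigenvalues of $\Xi$ come in time-reversal pairs $(e^{i\lambda_i},e^{-i\lambda_i})$. Therefore the Bott index $$N=\frac{1}{2\pi i}\operatorname{Tr}\log\left(mqm^\dagger q^\dagger\right)=\frac{1}{4\pi i}\operatorname{Tr}\log(\Xi)$$ is exactly zero, as constrained by the $T$ symmetry.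
   Context: The Hilbert space is finite dimensional and is a tensor product of a two-dimensional particle-hole space (Pauli matrices $\tau$), a spin space (Pauli matrices $s$), and the space of lattice sites and other internal degrees of freedom. Class DIII: before passing to the eigenbasis of $C$, the symmetry operators are $T=is_y\mathcal K$, $P=\tau_ys_y\mathcal K$ and $C=-iTP=\tau_y$, where $\mathcal K$ is complex conjugation; $T$ and $P$ are antiunitary, $T$ commutes with $H$, while $P$ and $C$ anticommute with $H$, and $T^2=-1$. A unitary change of basis in the $\tau$ space brings $C$ to $\tau_z$, and $H$ then has the stated off-diagonal form. With a singular value decomposition $h=U_A\Sigma U_B^\dagger$, put $q=U_AU_B^\dagger$ (a unitary matrix) and $Q=\begin{pmatrix}0&q\\ q^\dagger&0\end{pmatrix}$. The matrix $m=e^{2\pi i f(\boldsymbol r)}$ is unitary, where $f(\boldsymbol r)$ is a real polynomial of the position operator $\boldsymbol r$ (diagonal in the site basis and acting as the identity on spin), and $M=\tau_0\otimes m$ with $\tau_0$ the $2\times2$ identity. $\log$ is the principal logarithm.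
   Formalization: H is assumed gapped (0 is not an eigenvalue), since otherwise q is not determined and TQT^{-1}=Q can fail; N=0 is claimed only when -1 is not an eigenvalue of mqm†q†, since otherwise the principal logarithm is undefined or N is nonzero. *)

theory Defs
  imports "HOL-Analysis.Analysis"
begin

section \<open>Complex matrices\<close>

definition dagger :: "complex^'n^'m \<Rightarrow> complex^'m^'n" where
  "dagger A = (\<chi> i j. cnj (A $ j $ i))"

definition hermitian :: "complex^'n^'n \<Rightarrow> bool" where
  "hermitian A \<longleftrightarrow> dagger A = A"

definition unitary :: "complex^'n^'n \<Rightarrow> bool" where
  "unitary U \<longleftrightarrow> dagger U ** U = mat 1 \<and> U ** dagger U = mat 1"

definition diag :: "('n \<Rightarrow> complex) \<Rightarrow> complex^'n^'n" where
  "diag d = (\<chi> i j. if i = j then d i else 0)"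

definition eigenvalue :: "complex^'n^'n \<Rightarrow> complex \<Rightarrow> bool" where
  "eigenvalue A c \<longleftrightarrow> (\<exists>v. v \<noteq> 0 \<and> A *v v = c *s v)"

definition kron :: "complex^'a^'a \<Rightarrow> complex^'b^'b \<Rightarrow> complex^('a \<times> 'b)^('a \<times> 'b)" where
  "kron A B = (\<chi> i j. A $ fst i $ fst j * B $ snd i $ snd j)"

definition offdiag :: "complex^'n^'n \<Rightarrow> complex^'n^'n \<Rightarrow> complex^(2 \<times> 'n)^(2 \<times> 'n)" where
  "offdiag B C = (\<chi> i j. if fst i = 1 \<and> fst j = 2 then B $ snd i $ snd j
                         else if fst i = 2 \<and> fst j = 1 then C $ snd i $ snd j else 0)"

definition is_svd :: "complex^'n^'n \<Rightarrow> complex^'n^'n \<Rightarrow> ('n \<Rightarrow> real) \<Rightarrow> complex^'n^'n \<Rightarrow> bool" where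
  "is_svd h UA \<sigma> UB \<longleftrightarrow> unitary UA \<and> unitary UB \<and> (\<forall>i. 0 \<le> \<sigma> i) \<and>
     h = UA ** diag (\<lambda>i. complex_of_real (\<sigma> i)) ** dagger UB"

definition orthonormal_basis :: "('n \<Rightarrow> complex^'n) \<Rightarrow> bool" where
  "orthonormal_basis w \<longleftrightarrow> unitary (\<chi> i j. w j $ i)"

text \<open>The functional calculus \<open>g(A)\<close> of a normal (unitarily diagonalizable) matrix; the lemma
  \<open>mat_fun_eq\<close> below shows that it does not depend on the diagonalization.\<close>

definition mat_fun :: "(complex \<Rightarrow> complex) \<Rightarrow> complex^'n^'n \<Rightarrow> complex^'n^'n" where
  "mat_fun g A = (THE L. \<exists>V d. unitary V \<and> A = V ** diag d ** dagger V \<and>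
                              L = V ** diag (\<lambda>i. g (d i)) ** dagger V)"

text \<open>\<open>Ln\<close> is the principal branch, with imaginary part in \<open>(-\<pi>, \<pi>]\<close>.\<close>

definition mat_log :: "complex^'n^'n \<Rightarrow> complex^'n^'n" where
  "mat_log A = mat_fun Ln A"

lemma diag_mult_left: "(diag d ** A) $ i $ j = d i * A $ i $ j"
  by (simp add: diag_def matrix_matrix_mult_def if_distrib[of "\<lambda>x. x * _"] cong: if_cong)

lemma diag_mult_right: "(A ** diag d) $ i $ j = A $ i $ j * d j"
  by (simp add: diag_def matrix_matrix_mult_def if_distrib[of "\<lambda>x. _ * x"] cong: if_cong)

lemma mat_fun_eq:
  assumes V: "unitary V"
  shows "mat_fun g (V ** diag d ** dagger V) = V ** diag (\<lambda>i. g (d i)) ** dagger V"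
  unfolding mat_fun_def
proof (rule the_equality)
  show "\<exists>W e. unitary W \<and> V ** diag d ** dagger V = W ** diag e ** dagger W \<and>
      V ** diag (\<lambda>i. g (d i)) ** dagger V = W ** diag (\<lambda>i. g (e i)) ** dagger W"
    using V by blast
next
  fix L
  assume "\<exists>W e. unitary W \<and> V ** diag d ** dagger V = W ** diag e ** dagger W \<and>
      L = W ** diag (\<lambda>i. g (e i)) ** dagger W"
  then obtain W e where W: "unitary W"
    and eq: "V ** diag d ** dagger V = W ** diag e ** dagger W"
    and L: "L = W ** diag (\<lambda>i. g (e i)) ** dagger W" by blast
  define S where "S = dagger W ** V"
  have v: "dagger V ** V = mat 1" "V ** dagger V = mat 1"
    and w: "dagger W ** W = mat 1" "W ** dagger W = mat 1"
    using V W by (auto simp: unitary_def)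
  have "dagger W ** (V ** diag d ** dagger V) ** V = dagger W ** (W ** diag e ** dagger W) ** V"
    by (simp only: eq)
  moreover have "dagger W ** (V ** diag d ** dagger V) ** V = S ** diag d ** (dagger V ** V)"
    by (simp only: S_def matrix_mul_assoc)
  moreover have "dagger W ** (W ** diag e ** dagger W) ** V = (dagger W ** W) ** diag e ** S"
    by (simp only: S_def matrix_mul_assoc)
  ultimately have c: "S ** diag d = diag e ** S"
    by (simp add: v w)
  have "S ** diag (\<lambda>i. g (d i)) = diag (\<lambda>i. g (e i)) ** S"
  proof -
    have "S $ i $ j * g (d j) = g (e i) * S $ i $ j" for i j
    proof -
      have "S $ i $ j * d j = e i * S $ i $ j"
        using c by (metis diag_mult_left diag_mult_right)
      then show ?thesis by (cases "S $ i $ j = 0") auto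
    qed
    then show ?thesis by (simp add: vec_eq_iff diag_mult_left diag_mult_right)
  qed
  then have "W ** (S ** diag (\<lambda>i. g (d i))) ** dagger V = W ** (diag (\<lambda>i. g (e i)) ** S) ** dagger V"
    by simp
  moreover have "W ** (S ** diag (\<lambda>i. g (d i))) ** dagger V
      = (W ** dagger W) ** V ** diag (\<lambda>i. g (d i)) ** dagger V"
    by (simp only: S_def matrix_mul_assoc)
  moreover have "W ** (diag (\<lambda>i. g (e i)) ** S) ** dagger V
      = W ** diag (\<lambda>i. g (e i)) ** dagger W ** (V ** dagger V)"
    by (simp only: S_def matrix_mul_assoc)
  ultimately show "L = V ** diag (\<lambda>i. g (d i)) ** dagger V"
    by (simp add: L v w)
qed

section \<open>Symmetry class DIII\<close>

text \<open>The Hilbert space has index type \<open>2 \<times> 2 \<times> 'x \<times> 'o\<close>: particle-hole, spin, lattice site,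
  other internal degrees of freedom. In the type \<open>2\<close> the two values are written \<open>1\<close> and \<open>2\<close>.\<close>

definition pauli_y :: "complex^2^2" where
  "pauli_y = vector [vector [0, - \<i>], vector [\<i>, 0]]"

definition pauli_z :: "complex^2^2" where
  "pauli_z = vector [vector [1, 0], vector [0, - 1]]"

type_synonym ('x, 'o) bdg_vec = "complex^(2 \<times> 2 \<times> 'x \<times> 'o)"
type_synonym ('x, 'o) bdg_mat = "complex^(2 \<times> 2 \<times> 'x \<times> 'o)^(2 \<times> 2 \<times> 'x \<times> 'o)"

definition conj_vec :: "complex^'n \<Rightarrow> complex^'n" where
  "conj_vec v = (\<chi> i. cnj (v $ i))"

definition T0 :: "('x::finite, 'o::finite) bdg_vec \<Rightarrow> ('x, 'o) bdg_vec" where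
  "T0 v = \<i> *s (kron (mat 1) (kron pauli_y (mat 1)) *v conj_vec v)"

definition P0 :: "('x::finite, 'o::finite) bdg_vec \<Rightarrow> ('x, 'o) bdg_vec" where
  "P0 v = kron pauli_y (kron pauli_y (mat 1)) *v conj_vec v"

definition class_DIII :: "('x::finite, 'o::finite) bdg_mat \<Rightarrow> bool" where
  "class_DIII H \<longleftrightarrow> hermitian H \<and>
     (\<forall>v. T0 (H *v v) = H *v T0 v) \<and> (\<forall>v. P0 (H *v v) = - (H *v P0 v))"

text \<open>Change of basis by a \<open>2 \<times> 2\<close> matrix \<open>u\<close> acting in particle-hole space.\<close>

definition tau_rot :: "complex^2^2 \<Rightarrow> ('x::finite, 'o::finite) bdg_mat" where
  "tau_rot u = kron u (mat 1)"

definition rot_mat :: "complex^2^2 \<Rightarrow> ('x::finite, 'o::finite) bdg_mat \<Rightarrow> ('x, 'o) bdg_mat" where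
  "rot_mat u A = tau_rot u ** A ** dagger (tau_rot u)"

definition rot_op :: "complex^2^2 \<Rightarrow> (('x::finite, 'o::finite) bdg_vec \<Rightarrow> ('x, 'o) bdg_vec) \<Rightarrow>
    ('x, 'o) bdg_vec \<Rightarrow> ('x, 'o) bdg_vec" where
  "rot_op u F v = tau_rot u *v F (dagger (tau_rot u) *v v)"

definition chiral :: "(complex^'n \<Rightarrow> complex^'n) \<Rightarrow> (complex^'n \<Rightarrow> complex^'n) \<Rightarrow> complex^'n^'n" where
  "chiral T P = matrix (\<lambda>v. (- \<i>) *s T (P v))"

definition conj_op :: "(complex^'n \<Rightarrow> complex^'n) \<Rightarrow> complex^'n^'n \<Rightarrow> complex^'n \<Rightarrow> complex^'n" where
  "conj_op T A = (\<lambda>v. T (A *v inv T v))"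

section \<open>The Bott index\<close>

text \<open>\<open>f(r)\<close>, where \<open>pos x\<close> is the position of the site \<open>x\<close>: the components of \<open>r\<close> are
  simultaneously diagonal, so a polynomial in them acts entrywise on the diagonal.\<close>

definition pos_fun :: "(real^'d \<Rightarrow> real) \<Rightarrow> ('x \<Rightarrow> real^'d) \<Rightarrow>
    complex^(2 \<times> 'x::finite \<times> 'o::finite)^(2 \<times> 'x \<times> 'o)" where
  "pos_fun f pos = diag (\<lambda>(s, x, a). complex_of_real (f (pos x)))"

definition phase_mat :: "(real^'d \<Rightarrow> real) \<Rightarrow> ('x \<Rightarrow> real^'d) \<Rightarrow>
    complex^(2 \<times> 'x::finite \<times> 'o::finite)^(2 \<times> 'x \<times> 'o)" where
  "phase_mat f pos = mat_fun (\<lambda>z. exp (2 * of_real pi * \<i> * z)) (pos_fun f pos)"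

definition Xi :: "complex^'n^'n \<Rightarrow> complex^'n^'n \<Rightarrow> complex^'n^'n \<Rightarrow> complex^'n^'n" where
  "Xi C M Q = ((1/2) *\<^sub>R (mat 1 + C)) ** (M ** Q ** dagger M ** Q)
            + ((1/2) *\<^sub>R (mat 1 - C)) ** (dagger M ** Q ** M ** Q)"

text \<open>The principal logarithm of \<open>m q m\<^sup>\<dagger> q\<^sup>\<dagger>\<close> is a priori only meaningful when \<open>-1\<close> is not an
  eigenvalue. Here \<open>Ln (-1) = \<i>\<pi>\<close> makes \<open>bott_index\<close> total, but a time-reversal pair at \<open>-1\<close> does
  not cancel: for two sites with \<open>m = diag(1, -1)\<close> and \<open>q = \<sigma>\<^sub>x\<close>, both acting as the identity on
  spin, it has the value \<open>2\<close>. Vanishing thus requires that \<open>-1\<close> is not an eigenvalue.\<close>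

definition bott_index :: "complex^'n^'n \<Rightarrow> complex^'n^'n \<Rightarrow> complex" where
  "bott_index m q = 1 / (2 * of_real pi * \<i>) * trace (mat_log (m ** q ** dagger m ** dagger q))"

end

theory Submission
  imports Defs "HOL-Computational_Algebra.Fundamental_Theorem_Algebra"
begin

text \<open>In the chiral basis \<open>T\<close> swaps the two \<open>\<tau>\<close> blocks, \<open>T = a \<tau>\<^sub>x \<otimes> J\<close> with \<open>J = i s\<^sub>y K\<close> and
  \<open>|a| = 1\<close>. Commuting with \<open>H\<close> means \<open>J h = h\<^sup>\<dagger> J\<close>, and by uniqueness of the polar decomposition the
  unitary factor of \<open>h\<close> satisfies \<open>J q = q\<^sup>\<dagger> J\<close>. The matrix \<open>\<Xi>\<close> is block diagonal with blocks
  \<open>A = m q m\<^sup>\<dagger> q\<^sup>\<dagger>\<close> and \<open>B = m\<^sup>\<dagger> q\<^sup>\<dagger> m q\<close>, which are unitarily equivalent, so \<open>Tr log \<Xi> = 2 Tr log A\<close>.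
  On the other hand \<open>T\<close> maps eigenvectors of \<open>A\<close> in the first block to eigenvectors of \<open>B\<close> in the
  second one with conjugate eigenvalues, so in that basis \<open>Tr log \<Xi>\<close> is a sum of terms
  \<open>Ln d + Ln (cnj d)\<close>, each of which vanishes unless \<open>d = -1\<close>.\<close>

section \<open>Orthonormal bases and the functional calculus\<close>

text \<open>The sesquilinear form, conjugate linear in the first slot; \<open>inner\<close> on
  \<open>complex^'n\<close> is only its real part.\<close>

definition cinner :: "complex^'n \<Rightarrow> complex^'n \<Rightarrow> complex" where
  "cinner x y = (\<Sum>i\<in>UNIV. cnj (x $ i) * y $ i)"

lemma cinner_add_right: "cinner x (y + z) = cinner x y + cinner x z"
  by (simp add: cinner_def algebra_simps sum.distrib)

lemma cinner_diff_right: "cinner x (y - z) = cinner x y - cinner x z"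
  by (simp add: cinner_def algebra_simps sum_subtractf)

lemma cinner_zero_right [simp]: "cinner x 0 = 0"
  by (simp add: cinner_def)

lemma cinner_sum_right: "cinner x (\<Sum>s\<in>S. f s) = (\<Sum>s\<in>S. cinner x (f s))"
  by (induction S rule: infinite_finite_induct) (auto simp: cinner_add_right)

lemma cinner_scale_right: "cinner x (c *s y) = c * cinner x y"
  by (simp add: cinner_def sum_distrib_left algebra_simps)

lemma cinner_scale_left: "cinner (c *s x) y = cnj c * cinner x y"
  by (simp add: cinner_def sum_distrib_left algebra_simps)

lemma cnj_cinner: "cnj (cinner x y) = cinner y x"
  by (simp add: cinner_def mult.commute)

lemma cinner_self: "cinner x x = of_real ((norm x)\<^sup>2)"
proof -
  have "(norm x)\<^sup>2 = (\<Sum>i\<in>UNIV. (norm (x $ i))\<^sup>2)"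
    by (simp add: norm_vec_def L2_set_def sum_nonneg)
  then show ?thesis
    by (simp add: cinner_def complex_norm_square mult.commute flip: of_real_power)
qed

lemma cinner_dagger: "cinner (dagger A *v x) y = cinner x (A *v y)"
proof -
  have "cinner (dagger A *v x) y = (\<Sum>i\<in>UNIV. \<Sum>j\<in>UNIV. A $ j $ i * cnj (x $ j) * y $ i)"
    by (simp add: cinner_def dagger_def matrix_vector_mult_def sum_distrib_right)
  also have "\<dots> = (\<Sum>j\<in>UNIV. \<Sum>i\<in>UNIV. A $ j $ i * cnj (x $ j) * y $ i)"
    by (rule sum.swap)
  also have "\<dots> = cinner x (A *v y)"
    by (simp add: cinner_def matrix_vector_mult_def sum_distrib_left algebra_simps)
  finally show ?thesis .
qed

lemma dagger_dagger [simp]: "dagger (dagger A) = A"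
  by (simp add: dagger_def vec_eq_iff)

lemma dagger_mult: "dagger (A ** B) = dagger B ** dagger A"
  by (simp add: dagger_def vec_eq_iff matrix_matrix_mult_def mult.commute)

lemma dagger_mat_1 [simp]: "dagger (mat 1) = mat 1"
  by (simp add: dagger_def vec_eq_iff mat_def)

lemma unitary_dagger: "unitary U \<Longrightarrow> unitary (dagger U)"
  by (simp add: unitary_def)

lemma unitary_mult:
  assumes "unitary U" "unitary V"
  shows "unitary (U ** V)"
proof -
  have "dagger (U ** V) ** (U ** V) = dagger V ** (dagger U ** U) ** V"
    "(U ** V) ** dagger (U ** V) = U ** (V ** dagger V) ** dagger U"
    by (simp_all only: dagger_mult matrix_mul_assoc)
  with assms show ?thesis
    by (simp add: unitary_def)
qed

lemma unitary_iff_left: "unitary U \<longleftrightarrow> dagger U ** U = mat 1"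
  using matrix_left_right_inverse by (auto simp: unitary_def)

lemma cinner_unitary:
  assumes "unitary U"
  shows "cinner (U *v x) (U *v y) = cinner x y"
proof -
  have "cinner (U *v x) (U *v y) = cinner (dagger U *v (U *v x)) y"
    by (simp add: cinner_dagger)
  with assms show ?thesis
    by (simp add: matrix_vector_mul_assoc unitary_def)
qed

lemma orthonormal_basis_iff:
  "orthonormal_basis w \<longleftrightarrow> (\<forall>i j. cinner (w i) (w j) = (if i = j then 1 else 0))"
  by (simp add: orthonormal_basis_def unitary_iff_left vec_eq_iff matrix_matrix_mult_def dagger_def
      cinner_def mat_def)

lemma orthonormal_basis_nonzero:
  assumes "orthonormal_basis w"
  shows "w i \<noteq> 0"
proof
  assume "w i = 0"
  then have "cinner (w i) (w i) = 0" by simp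
  with assms show False by (simp add: orthonormal_basis_iff)
qed

lemma orthonormal_basis_unitary:
  "orthonormal_basis w \<Longrightarrow> unitary U \<Longrightarrow> orthonormal_basis (\<lambda>i. U *v w i)"
  by (simp add: orthonormal_basis_iff cinner_unitary)

text \<open>The eigenvectors are the columns of a diagonalizing unitary, and the trace is cyclic.
  Any orthonormal eigenbasis may be used, so evaluating one trace in two different bases yields an
  identity between sums.\<close>

lemma trace_mat_fun:
  assumes w: "orthonormal_basis w" and ev: "\<And>i. A *v w i = d i *s w i"
  shows "trace (mat_fun g A) = (\<Sum>i\<in>UNIV. g (d i))"
proof -
  define V :: "complex^'a^'a" where "V = (\<chi> i j. w j $ i)"
  have V: "unitary V"
    using w by (simp add: V_def orthonormal_basis_def)
  have "(A ** V) $ i $ j = (A *v w j) $ i" for i j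
    by (simp add: V_def matrix_matrix_mult_def matrix_vector_mult_def)
  then have "A ** V = V ** diag d"
    by (simp add: vec_eq_iff diag_mult_right ev) (simp add: V_def)
  then have "A ** (V ** dagger V) = V ** diag d ** dagger V"
    by (simp add: matrix_mul_assoc)
  then have "A = V ** diag d ** dagger V"
    using V by (simp add: unitary_def)
  then have "mat_fun g A = (V ** diag (\<lambda>i. g (d i))) ** dagger V"
    using mat_fun_eq[OF V] by simp
  also have "trace \<dots> = trace (dagger V ** (V ** diag (\<lambda>i. g (d i))))"
    by (rule trace_mul_sym)
  also have "\<dots> = trace (diag (\<lambda>i. g (d i)))"
    using V by (simp add: matrix_mul_assoc unitary_def)
  also have "\<dots> = (\<Sum>i\<in>UNIV. g (d i))"
    by (simp add: trace_def diag_def)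
  finally show ?thesis .
qed

section \<open>Diagonalization of unitary matrices\<close>

definition poly_act :: "complex poly \<Rightarrow> complex^'n^'n \<Rightarrow> complex^'n \<Rightarrow> complex^'n" where
  "poly_act p A v = (\<Sum>i\<le>degree p. coeff p i *s (((*v) A) ^^ i) v)"

lemma poly_act_eq:
  assumes "degree p \<le> n"
  shows "poly_act p A v = (\<Sum>i\<le>n. coeff p i *s (((*v) A) ^^ i) v)"
  unfolding poly_act_def
  by (rule sum.mono_neutral_left) (use assms in \<open>auto simp: coeff_eq_0\<close>)

lemma funpow_matrix_diff_scale:
  fixes A :: "complex^'n^'n"
  shows "(((*v) A) ^^ i) (A *v v - c *s v) = (((*v) A) ^^ Suc i) v - c *s (((*v) A) ^^ i) v"
proof (induction i)
  case (Suc i)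
  then show ?case
    by (simp add: matrix_vector_mult_diff_distrib vector_scalar_commute)
qed simp

text \<open>Powers of A commute with A - c, so a linear factor of the polynomial can be moved onto
  the vector. Multiplication by X shifts the coefficients by one, which matches the extra
  application of A.\<close>

lemma poly_act_linear_factor:
  fixes A :: "complex^'n^'n"
  shows "poly_act ([:- c, 1:] * r) A v = poly_act r A (A *v v - c *s v)"
proof -
  define n where "n = degree r"
  let ?p = "[:- c, 1:] * r" and ?a = "\<lambda>i. (((*v) A) ^^ i) v"
  have p: "?p = pCons 0 r - smult c r"
    by simp
  have "degree ?p \<le> Suc n"
    using degree_mult_le[of "[:- c, 1:]" r] by (simp add: n_def)
  then have "poly_act ?p A v = (\<Sum>i\<le>Suc n. coeff ?p i *s ?a i)"
    by (rule poly_act_eq)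
  also have "\<dots> = (\<Sum>i\<le>Suc n. coeff (pCons 0 r) i *s ?a i) - (\<Sum>i\<le>Suc n. (c * coeff r i) *s ?a i)"
    unfolding p by (simp only: coeff_diff coeff_smult vec.scale_left_diff_distrib sum_subtractf)
  also have "(\<Sum>i\<le>Suc n. coeff (pCons 0 r) i *s ?a i) = (\<Sum>i\<le>n. coeff r i *s ?a (Suc i))"
    by (subst sum.atMost_Suc_shift) simp
  also have "(\<Sum>i\<le>Suc n. (c * coeff r i) *s ?a i) = (\<Sum>i\<le>n. (c * coeff r i) *s ?a i)"
    by (simp add: n_def coeff_eq_0)
  also have "(\<Sum>i\<le>n. coeff r i *s ?a (Suc i)) - \<dots> = (\<Sum>i\<le>n. coeff r i *s (((*v) A) ^^ i) (A *v v - c *s v))"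
    by (simp only: funpow_matrix_diff_scale vec.scale_right_diff_distrib sum_subtractf
        vec.scale_scale mult.commute)
  also have "\<dots> = poly_act r A (A *v v - c *s v)"
    by (simp add: poly_act_def n_def)
  finally show ?thesis .
qed

text \<open>The n + 1 vectors v, A v, ..., A^n v in dimension n are linearly dependent, and the
  coefficients of a dependency form the polynomial.\<close>

lemma ex_annihilating_poly:
  fixes A :: "complex^'n^'n"
  shows "\<exists>p. p \<noteq> 0 \<and> poly_act p A v = 0"
proof (cases "inj_on (\<lambda>i. (((*v) A) ^^ i) v) {..CARD('n)}")
  case True
  let ?a = "\<lambda>i. (((*v) A) ^^ i) v"
  let ?S = "?a ` {..CARD('n)}"
  have "card ?S = Suc CARD('n)"
    using True by (simp add: card_image)
  moreover have "vec.dim ?S \<le> CARD('n)"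
    using vec.dim_subset_UNIV[of ?S] by (simp add: vec.dimension_def card_cart_basis)
  ultimately have "vec.dependent ?S"
    by (intro vec.dependent_biggerset_general) simp
  then obtain u s where u: "(\<Sum>x\<in>?S. u x *s x) = 0" and s: "s \<in> ?S" "u s \<noteq> 0"
    using vec.dependent_finite[of ?S] by auto
  define p where "p = (\<Sum>i\<le>CARD('n). monom (u (?a i)) i)"
  have coeff_p: "coeff p i = (if i \<le> CARD('n) then u (?a i) else 0)" for i
    by (simp add: p_def coeff_sum)
  have "p \<noteq> 0"
    using s coeff_p by (metis (no_types, lifting) atMost_iff coeff_0 imageE)
  moreover have "degree p \<le> CARD('n)"
    by (rule degree_le) (simp add: coeff_p)
  then have "poly_act p A v = (\<Sum>i\<le>CARD('n). u (?a i) *s ?a i)"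
    by (simp add: poly_act_eq coeff_p)
  then have "poly_act p A v = 0"
    using u sum.reindex[OF True, of "\<lambda>x. u x *s x"] by simp
  ultimately show ?thesis by blast
\<comment> \<open>If two iterates coincide, the set of iterates may be too small for the dimension
  count, but then X^i - X^j annihilates v.\<close>
next
  case False
  let ?a = "\<lambda>i. (((*v) A) ^^ i) v"
  obtain i j where ij: "i \<noteq> j" "?a i = ?a j"
    using False by (auto simp: inj_on_def)
  define p where "p = monom (1::complex) i - monom 1 j"
  have "coeff p i = 1"
    using ij by (simp add: p_def)
  then have "p \<noteq> 0"
    by auto
  have "degree p \<le> max i j"
    unfolding p_def by (meson degree_diff_le degree_monom_le max.cobounded1 max.cobounded2 order_trans)
  then have "poly_act p A v = (\<Sum>k\<le>max i j. coeff p k *s ?a k)"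
    by (rule poly_act_eq)
  also have "\<dots> = (\<Sum>k\<le>max i j. if k = i then ?a i else 0) - (\<Sum>k\<le>max i j. if k = j then ?a j else 0)"
    unfolding sum_subtractf[symmetric] by (rule sum.cong) (auto simp: p_def)
  also have "\<dots> = 0"
    using ij by simp
  finally show ?thesis
    using \<open>p \<noteq> 0\<close> by blast
qed

text \<open>Split off a root c of p. Either A v = c v, or (A - c) v is a nonzero vector of W
  annihilated by the quotient, which has smaller degree.\<close>

lemma eigenvector_if_annihilated:
  fixes A :: "complex^'n^'n"
  assumes W: "vec.subspace W" "\<And>x. x \<in> W \<Longrightarrow> A *v x \<in> W"
    and "p \<noteq> 0" "poly_act p A v = 0" "v \<in> W" "v \<noteq> 0"
  shows "\<exists>c w. w \<in> W \<and> w \<noteq> 0 \<and> A *v w = c *s w"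
  using assms(3-)
proof (induction "degree p" arbitrary: p v)
  case 0
  then obtain a where "p = [:a:]" "a \<noteq> 0"
    by (metis degree_eq_zeroE pCons_0_0)
  with 0 show ?case
    by (simp add: poly_act_def vec.scale_eq_0_iff)
next
  case (Suc n)
  then obtain c where "poly p c = 0"
    using fundamental_theorem_of_algebra[of p] constant_degree[of p] by auto
  then obtain r where r: "p = [:- c, 1:] * r"
    by (auto simp: poly_eq_0_iff_dvd)
  have r0: "r \<noteq> 0"
    using r Suc.prems by auto
  have "degree p = Suc (degree r)"
    unfolding r using r0 by (subst degree_mult_eq) auto
  with Suc.hyps(2) have deg: "n = degree r" by simp
  show ?case
  proof (cases "A *v v - c *s v = 0")
    case True
    then show ?thesis using Suc.prems by auto
  next
    case False
    have "poly_act r A (A *v v - c *s v) = 0"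
      using Suc.prems(2) unfolding r poly_act_linear_factor .
    moreover have "A *v v - c *s v \<in> W"
      using W Suc.prems by (intro vec.subspace_diff vec.subspace_scale)
    ultimately show ?thesis
      using Suc.hyps(1)[OF deg r0] False by blast
  qed
qed

text \<open>A maximal orthonormal set of eigenvectors spans: otherwise its orthogonal complement is a
  nonzero invariant subspace, hence contains a further eigenvector.\<close>

lemma unitary_diagonalizable:
  fixes A :: "complex^'n^'n"
  assumes A: "unitary A"
  shows "\<exists>w d. orthonormal_basis w \<and> (\<forall>i. A *v w i = d i *s w i \<and> norm (d i) = 1)"
proof -
  have norm_ev: "norm c = 1" if "A *v x = c *s x" "x \<noteq> 0" for c x
  proof -
    have "cinner x x = (cnj c * c) * cinner x x"
      using cinner_unitary[OF A, of x x] that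
      by (simp add: cinner_scale_left cinner_scale_right mult_ac)
    moreover have "cinner x x \<noteq> 0"
      using that by (simp add: cinner_self)
    ultimately have "cnj c * c = 1" by (metis mult_cancel_right2 mult.commute)
    then have "(norm c)\<^sup>2 = 1"
      by (metis complex_norm_square mult.commute of_real_eq_1_iff)
    then show ?thesis
      by (simp add: power2_eq_1_iff) (metis norm_ge_zero not_one_le_zero neg_0_le_iff_le)
  qed
  define good where "good S \<longleftrightarrow> (\<forall>x\<in>S. \<forall>y\<in>S. cinner x y = (if x = y then 1 else 0)) \<and>
    (\<forall>x\<in>S. \<exists>c. A *v x = c *s x)" for S :: "(complex^'n) set"
  \<comment> \<open>Pairing a vanishing combination with one of its members isolates that
    coefficient. Independence bounds the cardinality, so a largest \<open>good\<close> set
    exists.\<close>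
  have indep: "vec.independent S" if S: "good S" for S
  proof (unfold vec.independent_explicit_finite_subsets, intro allI impI ballI)
    fix R u x assume R: "R \<subseteq> S" "finite R" and u: "(\<Sum>y\<in>R. u y *s y) = 0" and x: "x \<in> R"
    have "0 = cinner x (\<Sum>y\<in>R. u y *s y)"
      by (simp add: u)
    also have "\<dots> = (\<Sum>y\<in>R. if y = x then u x else 0)"
      unfolding cinner_sum_right using S R x
      by (intro sum.cong) (auto simp: cinner_scale_right good_def subset_iff)
    finally show "u x = 0"
      using R x by simp
  qed
  have card_le: "finite S \<and> card S \<le> CARD('n)" if "good S" for S
    using indep[OF that] vec.independent_bound_general[of S] vec.dim_subset_UNIV[of S]
    by (auto simp: vec.dimension_def card_cart_basis)
  have "good {}"
    by (simp add: good_def)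
  moreover have "\<forall>S. good S \<longrightarrow> card S < Suc CARD('n)"
    using card_le by (simp add: less_Suc_eq_le)
  ultimately have "\<exists>S. good S \<and> (\<forall>R. good R \<longrightarrow> card R \<le> card S)"
    by (rule ex_has_greatest_nat)
  then obtain S where S: "good S" and max: "\<And>R. good R \<Longrightarrow> card R \<le> card S"
    by (elim exE conjE) simp
  have fin: "finite S"
    using card_le S by blast
  have "card S = CARD('n)"
  proof (rule ccontr)
    assume "card S \<noteq> CARD('n)"
    then have "vec.span S \<noteq> UNIV"
      using vec.span_card_ge_dim[of S UNIV] fin card_le[OF S] vec_dim_card[where 'a=complex and 'n='n]
      by auto
    then obtain x where x: "x \<notin> vec.span S" by blast
    define y where "y = x - (\<Sum>s\<in>S. cinner s x *s s)"
    define W where "W = {w. \<forall>s\<in>S. cinner s w = 0}"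
    have "y \<noteq> 0"
    proof
      assume "y = 0"
      then have "x = (\<Sum>s\<in>S. cinner s x *s s)" by (simp add: y_def)
      moreover have "(\<Sum>s\<in>S. cinner s x *s s) \<in> vec.span S"
        by (intro vec.span_sum vec.span_scale vec.span_base)
      ultimately show False using x by simp
    qed
    moreover have "y \<in> W"
    proof -
      have "cinner s (\<Sum>t\<in>S. cinner t x *s t) = cinner s x" if "s \<in> S" for s
      proof -
        have "cinner s (\<Sum>t\<in>S. cinner t x *s t) = (\<Sum>t\<in>S. if t = s then cinner s x else 0)"
          unfolding cinner_sum_right using S that
          by (intro sum.cong) (auto simp: cinner_scale_right good_def)
        then show ?thesis using fin that by simp
      qed
      then show ?thesis
        by (simp add: W_def y_def cinner_diff_right)
    qed
    moreover have "vec.subspace W"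
      by (auto simp: vec.subspace_def W_def cinner_add_right cinner_scale_right)
    \<comment> \<open>For an eigenvector s with eigenvalue c, unitarity gives cnj c <s, A w> = <A s,
      A w> = <s, w> = 0, and c is nonzero because it has modulus 1.\<close>
    moreover have "A *v w \<in> W" if "w \<in> W" for w
    proof -
      have "cinner s (A *v w) = 0" if s: "s \<in> S" for s
      proof -
        obtain c where c: "A *v s = c *s s"
          using S s unfolding good_def by blast
        have "cinner s s = 1"
          using S s by (simp add: good_def)
        then have "s \<noteq> 0"
          by auto
        then have "c \<noteq> 0"
          using norm_ev[OF c] by auto
        moreover have "cnj c * cinner s (A *v w) = 0"
          using cinner_unitary[OF A, of s w] s \<open>w \<in> W\<close> by (simp add: c cinner_scale_left W_def)
        ultimately show ?thesis by simp
      qed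
      then show ?thesis by (simp add: W_def)
    qed
    moreover obtain p where "p \<noteq> 0" "poly_act p A y = 0"
      using ex_annihilating_poly by blast
    ultimately have "\<exists>c v. v \<in> W \<and> v \<noteq> 0 \<and> A *v v = c *s v"
      by (intro eigenvector_if_annihilated)
    then obtain c v where v: "v \<in> W" "v \<noteq> 0" "A *v v = c *s v"
      by blast
    define z where "z = complex_of_real (inverse (norm v)) *s v"
    have zW: "cinner s z = 0" if "s \<in> S" for s
      using v that by (simp add: z_def W_def cinner_scale_right)
    then have zW': "cinner z s = 0" if "s \<in> S" for s
      using that by (metis cnj_cinner complex_cnj_zero)
    have zz: "cinner z z = 1"
      unfolding z_def cinner_scale_left unfolding cinner_scale_right unfolding cinner_self
      using v(2) by (simp add: power2_eq_square field_simps)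
    have "A *v z = c *s z"
      by (simp add: z_def vector_scalar_commute v(3) vector_smult_assoc mult.commute)
    then have "good (insert z S)"
      using S zW zW' zz by (auto simp: good_def)
    moreover have "z \<notin> S"
      using zW zz by auto
    ultimately show False
      using max[of "insert z S"] fin by simp
  qed
  then obtain w where w: "bij_betw w (UNIV :: 'n set) S"
    using fin by (metis finite bij_betw_iff_card)
  have wS: "w i \<in> S" and w_eq: "w i = w j \<longleftrightarrow> i = j" for i j
    using w by (auto simp: bij_betw_def inj_on_def)
  have on: "orthonormal_basis w"
    using S wS w_eq by (auto simp: orthonormal_basis_iff good_def)
  have "\<exists>c. A *v w i = c *s w i" for i
    using S wS[of i] unfolding good_def by blast
  then obtain d where d: "A *v w i = d i *s w i" for i
    by metis
  have "norm (d i) = 1" for i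
    using norm_ev[OF d] orthonormal_basis_nonzero[OF on] by simp
  with on d show ?thesis by blast
qed

section \<open>Block structure in particle-hole space\<close>

definition emb :: "2 \<Rightarrow> complex^'n \<Rightarrow> complex^(2 \<times> 'n)" where
  "emb b x = (\<chi> i. if fst i = b then x $ snd i else 0)"

text \<open>If they were equal, \<open>UNIV = {1, 2}\<close> would be a singleton.\<close>

lemma two_neq_one [simp]: "(2::2) \<noteq> 1"
proof
  assume "(2::2) = 1"
  then have "card (UNIV :: 2 set) = card {1 :: 2}"
    by (simp only: UNIV_2) simp
  then show False by simp
qed

lemma emb_nth: "emb b x $ (c, i) = (if c = b then x $ i else 0)"
  by (simp add: emb_def)

lemma emb_scale: "emb b (c *s x) = c *s emb b x"
  by (simp add: emb_def vec_eq_iff)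

lemma emb_eq_iff [simp]: "emb b x = emb b y \<longleftrightarrow> x = y"
  by (auto simp: emb_def vec_eq_iff)

lemma emb_0 [simp]: "emb b 0 = 0"
  by (simp add: emb_def vec_eq_iff)

lemma emb_decomp:
  obtains x y where "v = emb 1 x + emb 2 y"
proof -
  have "v = emb 1 (\<chi> i. v $ (1, i)) + emb 2 (\<chi> i. v $ (2, i))"
    by (simp add: vec_eq_iff emb_nth forall_2)
  then show thesis by (rule that)
qed

lemma sum_2_prod: "(\<Sum>i\<in>(UNIV :: (2 \<times> 'n::finite) set). g i) = (\<Sum>j\<in>UNIV. g (1, j)) + (\<Sum>j\<in>UNIV. g (2, j))"
proof -
  have "(\<Sum>i\<in>(UNIV :: (2 \<times> 'n) set). g i) = (\<Sum>b\<in>UNIV. \<Sum>j\<in>UNIV. g (b, j))"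
    by (simp add: sum.cartesian_product flip: UNIV_Times_UNIV)
  then show ?thesis by (simp add: sum_2)
qed

lemma cinner_emb: "cinner (emb b x) (emb c y) = (if b = c then cinner x y else 0)"
  using exhaust_2[of b] exhaust_2[of c]
  by (auto simp: cinner_def sum_2_prod emb_nth)

lemma kron_emb_nth: "(kron A B *v emb b x) $ (c, i) = A $ c $ b * (B *v x) $ i"
  using exhaust_2[of b]
  by (auto simp: matrix_vector_mult_def sum_2_prod emb_nth kron_def sum_distrib_left algebra_simps)

lemma kron_one_emb: "kron (mat 1) B *v emb b x = emb b (B *v x)"
  by (auto simp: vec_eq_iff kron_emb_nth emb_nth mat_def)

lemma offdiag_emb:
  "offdiag B C *v emb 1 x = emb 2 (C *v x)" "offdiag B C *v emb 2 x = emb 1 (B *v x)"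
  by (auto simp: vec_eq_iff matrix_vector_mult_def sum_2_prod emb_nth offdiag_def)

lemma pauli_z_emb:
  "kron pauli_z (mat 1) *v emb 1 x = emb 1 x" "kron pauli_z (mat 1) *v emb 2 x = - emb 2 x"
  by (auto simp: vec_eq_iff kron_emb_nth emb_nth pauli_z_def forall_2)

lemma orthonormal_basis_emb:
  fixes w1 w2 :: "'n::finite \<Rightarrow> complex^'n"
  assumes "orthonormal_basis w1" "orthonormal_basis w2"
  shows "orthonormal_basis (\<lambda>(b :: 2, i). if b = 1 then emb 1 (w1 i) else emb 2 (w2 i))"
  using assms by (auto simp: orthonormal_basis_iff cinner_emb forall_2)

section \<open>Algebra of Kronecker products\<close>

lemma kron_mult: "kron A B ** kron C D = kron (A ** C) (B ** D)"
proof -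
  have "(kron A B ** kron C D) $ (i, i') $ (j, j') = kron (A ** C) (B ** D) $ (i, i') $ (j, j')"
    for i i' j j'
    unfolding matrix_matrix_mult_def kron_def
    by (simp add: sum_product sum.cartesian_product algebra_simps flip: UNIV_Times_UNIV)
      (simp add: case_prod_beta)
  then show ?thesis by (simp add: vec_eq_iff)
qed

lemma dagger_kron: "dagger (kron A B) = kron (dagger A) (dagger B)"
  by (simp add: dagger_def kron_def vec_eq_iff)

lemma kron_mat_1: "kron (mat 1) (mat 1) = mat 1"
  by (auto simp: kron_def vec_eq_iff mat_def)

lemma unitary_tau_rot: "unitary u \<Longrightarrow> unitary (tau_rot u)"
  by (simp add: unitary_def tau_rot_def dagger_kron kron_mult kron_mat_1)

section \<open>Complex conjugation and the symmetry operators\<close>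

definition conj_mat :: "complex^'n^'m \<Rightarrow> complex^'n^'m" where
  "conj_mat A = (\<chi> i j. cnj (A $ i $ j))"

lemma conj_vec_nth [simp]: "conj_vec v $ i = cnj (v $ i)"
  by (simp add: conj_vec_def)

lemma conj_vec_conj_vec [simp]: "conj_vec (conj_vec v) = v"
  by (simp add: vec_eq_iff)

lemma conj_vec_add: "conj_vec (v + w) = conj_vec v + conj_vec w"
  by (simp add: vec_eq_iff)

lemma conj_vec_scale: "conj_vec (c *s v) = cnj c *s conj_vec v"
  by (simp add: vec_eq_iff)

lemma conj_vec_emb: "conj_vec (emb b x) = emb b (conj_vec x)"
  by (simp add: vec_eq_iff emb_nth)

lemma conj_vec_mult: "conj_vec (A *v v) = conj_mat A *v conj_vec v"
  by (simp add: vec_eq_iff matrix_vector_mult_def conj_mat_def)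

lemma conj_mat_mult: "conj_mat (A ** B) = conj_mat A ** conj_mat B"
  by (simp add: vec_eq_iff matrix_matrix_mult_def conj_mat_def)

lemma conj_mat_dagger: "conj_mat (dagger A) = dagger (conj_mat A)"
  by (simp add: vec_eq_iff dagger_def conj_mat_def)

lemma conj_mat_1 [simp]: "conj_mat (mat 1) = mat 1"
  by (simp add: vec_eq_iff mat_def conj_mat_def)

lemma unitary_conj_mat: "unitary U \<Longrightarrow> unitary (conj_mat U)"
  by (metis conj_mat_1 conj_mat_dagger conj_mat_mult unitary_def)

lemma conj_mat_kron: "conj_mat (kron A B) = kron (conj_mat A) (conj_mat B)"
  by (simp add: vec_eq_iff kron_def conj_mat_def)

lemma conj_mat_diag_real: "conj_mat (diag (\<lambda>i. complex_of_real (s i))) = diag (\<lambda>i. complex_of_real (s i))"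
  by (simp add: vec_eq_iff diag_def conj_mat_def)

lemma conj_mat_pauli_y: "conj_mat pauli_y = - pauli_y"
  by (simp add: vec_eq_iff conj_mat_def pauli_y_def forall_2)

lemma pauli_y_square: "pauli_y ** pauli_y = mat 1"
  by (simp add: vec_eq_iff matrix_matrix_mult_def pauli_y_def forall_2 sum_2 mat_def)

section \<open>Time reversal within one block and the polar factor\<close>

text \<open>This is J = i s_y K, the action of time reversal on a single particle-hole
  block.\<close>

definition spin_J :: "complex^(2 \<times> 'x::finite \<times> 'o::finite) \<Rightarrow> complex^(2 \<times> 'x \<times> 'o)" where
  "spin_J x = \<i> *s (kron pauli_y (mat 1) *v conj_vec x)"

lemma spin_J_nth: "spin_J x $ (1, k) = cnj (x $ (2, k))" "spin_J x $ (2, k) = - cnj (x $ (1, k))"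
  by (simp_all add: spin_J_def matrix_vector_mult_def sum_2_prod kron_def pauli_y_def mat_def
      if_distrib[of "\<lambda>z. z * _"] if_distrib[of "\<lambda>z. _ * z"] cong: if_cong)

lemma spin_J_minus: "spin_J (- x) = - spin_J x"
  by (simp add: vec_eq_iff forall_2 spin_J_nth)

lemma matrix_vector_mult_minus:
  fixes A :: "complex^'n^'m"
  shows "(- A) *v x = - (A *v x)" "A *v (- x) = - (A *v x)"
  by (simp_all add: vec_eq_iff matrix_vector_mult_def sum_negf)

lemma spin_J_spin_J: "spin_J (spin_J x) = - x"
  by (simp add: vec_eq_iff forall_2 spin_J_nth)

lemma cinner_spin_J: "cinner (spin_J x) (spin_J y) = cinner y x"
  by (simp add: cinner_def sum_2_prod spin_J_nth algebra_simps)

text \<open>The diagonal entries do not depend on the spin, so s_y commutes with the matrix and only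
  the complex conjugation acts on it.\<close>

lemma spin_J_diag: "spin_J (diag (\<lambda>(s, k). g k) *v x) = dagger (diag (\<lambda>(s, k). g k)) *v spin_J x"
proof -
  have d: "(diag e *v y) $ i = e i * y $ i" for e :: "'c::finite \<Rightarrow> complex" and y i
    by (simp add: matrix_vector_mult_def diag_def if_distrib[of "\<lambda>z. z * _"] cong: if_cong)
  have dd: "dagger (diag e) = diag (\<lambda>i. cnj (e i))" for e :: "'c::finite \<Rightarrow> complex"
    by (auto simp: vec_eq_iff dagger_def diag_def)
  show ?thesis
    by (simp add: vec_eq_iff forall_2 spin_J_nth d dd)
qed

text \<open>The unitary factor of the polar decomposition inherits the symmetry: with
  \<open>S = B\<^sup>\<dagger> Y A'\<close> and \<open>R = A\<^sup>\<dagger> Y B'\<close> the hypotheses say \<open>S \<Sigma> = \<Sigma> R\<close> and \<open>R \<Sigma> = \<Sigma> S\<close>, so that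
  \<open>(\<sigma> i + \<sigma> j) (S - R) i j = 0\<close>.\<close>

lemma polar_factor_intertwine:
  fixes A B A' B' Y :: "complex^'n^'n"
  assumes un: "unitary A" "unitary B" "unitary A'" "unitary B'"
    and pos: "\<And>i. \<sigma> i > 0"
    and eq1: "Y ** (A' ** diag (\<lambda>i. complex_of_real (\<sigma> i)) ** dagger B')
      = (B ** diag (\<lambda>i. complex_of_real (\<sigma> i)) ** dagger A) ** Y"
    and eq2: "Y ** (B' ** diag (\<lambda>i. complex_of_real (\<sigma> i)) ** dagger A')
      = (A ** diag (\<lambda>i. complex_of_real (\<sigma> i)) ** dagger B) ** Y"
  shows "Y ** (A' ** dagger B') = (B ** dagger A) ** Y"
proof -
  let ?D = "diag (\<lambda>i. complex_of_real (\<sigma> i))"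
  define S where "S = dagger B ** Y ** A'"
  define R where "R = dagger A ** Y ** B'"
  \<comment> \<open>Stated for arbitrary unitaries, so that it serves both hypotheses, the second
    one with A, B and A', B' interchanged.\<close>
  have half: "(dagger B ** Y ** A') ** ?D = ?D ** (dagger A ** Y ** B')"
    if un: "unitary A" "unitary B" "unitary A'" "unitary B'"
      and eq: "Y ** (A' ** ?D ** dagger B') = (B ** ?D ** dagger A) ** Y" for A B A' B' :: "complex^'n^'n"
  proof -
    have "(dagger B ** Y ** A') ** ?D = dagger B ** Y ** A' ** ?D ** (dagger B' ** B')"
      using un by (simp add: unitary_def)
    also have "\<dots> = dagger B ** (Y ** (A' ** ?D ** dagger B')) ** B'"
      by (simp only: matrix_mul_assoc)
    also have "\<dots> = dagger B ** ((B ** ?D ** dagger A) ** Y) ** B'"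
      by (simp only: eq)
    also have "\<dots> = (dagger B ** B) ** ?D ** (dagger A ** Y ** B')"
      by (simp only: matrix_mul_assoc)
    finally show ?thesis
      using un by (simp add: unitary_def)
  qed
  have SR: "S ** ?D = ?D ** R" "R ** ?D = ?D ** S"
    unfolding S_def R_def using half un eq1 eq2 by blast+
  have "S $ i $ j = R $ i $ j" for i j
  proof -
    have "S $ i $ j * \<sigma> j = \<sigma> i * R $ i $ j" "R $ i $ j * \<sigma> j = \<sigma> i * S $ i $ j"
      using SR by (metis diag_mult_left diag_mult_right)+
    then have "(complex_of_real (\<sigma> i + \<sigma> j)) * (S $ i $ j - R $ i $ j) = 0"
      by (simp add: algebra_simps)
    moreover have "\<sigma> i + \<sigma> j \<noteq> 0"
      using pos[of i] pos[of j] by linarith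
    ultimately show ?thesis
      by (metis mult_eq_0_iff of_real_eq_0_iff right_minus_eq)
  qed
  then have "S = R"
    by (simp add: vec_eq_iff)
  have "Y ** (A' ** dagger B') = (B ** dagger B) ** Y ** (A' ** dagger B')"
    using un by (simp add: unitary_def)
  also have "\<dots> = B ** S ** dagger B'"
    by (simp only: S_def matrix_mul_assoc)
  also have "\<dots> = B ** dagger A ** Y ** (B' ** dagger B')"
    unfolding \<open>S = R\<close> by (simp only: R_def matrix_mul_assoc)
  also have "\<dots> = (B ** dagger A) ** Y"
    using un by (simp add: unitary_def)
  finally show ?thesis .
qed

text \<open>Moving K to the right replaces A by its conjugate, and conjugate vectors exhaust the
  space. The antilinear relation thus becomes a matrix identity, the form that
  \<open>polar_factor_intertwine\<close> handles.\<close>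

lemma spin_J_intertwine_iff:
  "(\<forall>x. spin_J (A *v x) = B *v spin_J x) \<longleftrightarrow>
    kron pauli_y (mat 1) ** conj_mat A = B ** kron pauli_y (mat 1)"
proof -
  have "(\<forall>x. spin_J (A *v x) = B *v spin_J x) \<longleftrightarrow>
      (\<forall>x. kron pauli_y (mat 1) ** conj_mat A *v conj_vec x = B ** kron pauli_y (mat 1) *v conj_vec x)"
    by (simp add: spin_J_def conj_vec_mult vector_scalar_commute matrix_vector_mul_assoc)
  also have "\<dots> \<longleftrightarrow> (\<forall>x. kron pauli_y (mat 1) ** conj_mat A *v x = B ** kron pauli_y (mat 1) *v x)"
    by (metis conj_vec_conj_vec)
  finally show ?thesis
    by (simp add: matrix_eq)
qed

text \<open>Here \<open>polar_factor_intertwine\<close> is applied with Y = s_y and with the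
  conjugates of \<open>UA\<close> and \<open>UB\<close> as A' and B'. Interchanging the two sides of
  the decomposition gives the claim for \<open>dagger q\<close>.\<close>

lemma spin_J_polar_factor:
  assumes svd: "is_svd h UA \<sigma> UB" and pos: "\<And>i. \<sigma> i > 0"
    and h: "\<forall>x. spin_J (h *v x) = dagger h *v spin_J x"
      "\<forall>x. spin_J (dagger h *v x) = h *v spin_J x"
  defines "q \<equiv> UA ** dagger UB"
  shows "\<forall>x. spin_J (q *v x) = dagger q *v spin_J x"
    "\<forall>x. spin_J (dagger q *v x) = q *v spin_J x"
proof -
  let ?D = "diag (\<lambda>i. complex_of_real (\<sigma> i))"
  have un: "unitary UA" "unitary UB" "unitary (conj_mat UA)" "unitary (conj_mat UB)"
    and h_eq: "h = UA ** ?D ** dagger UB"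
    using svd by (auto simp: is_svd_def unitary_conj_mat)
  have dD: "dagger ?D = ?D"
    by (auto simp: vec_eq_iff dagger_def diag_def)
  have dh: "dagger h = UB ** ?D ** dagger UA"
    by (simp add: h_eq dagger_mult dD matrix_mul_assoc)
  note eqs = h[unfolded spin_J_intertwine_iff dh, unfolded h_eq conj_mat_mult conj_mat_dagger conj_mat_diag_real]
  have dq: "dagger q = UB ** dagger UA"
    by (simp add: q_def dagger_mult)
  show "\<forall>x. spin_J (q *v x) = dagger q *v spin_J x"
    unfolding spin_J_intertwine_iff dq unfolding q_def conj_mat_mult conj_mat_dagger
    by (rule polar_factor_intertwine[OF un pos eqs])
  show "\<forall>x. spin_J (dagger q *v x) = q *v spin_J x"
    unfolding spin_J_intertwine_iff dq unfolding q_def conj_mat_mult conj_mat_dagger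
    by (rule polar_factor_intertwine[OF un(2,1,4,3) pos eqs(2,1)])
qed

section \<open>The symmetry operators in the chiral basis\<close>

text \<open>Passing K to the right turns the adjoint of u into its transpose, so the particle-hole
  part of the rotated T is u u^T rather than a similarity transform.\<close>

lemma rot_op_T0:
  "rot_op u T0 v = \<i> *s (kron (u ** transpose u) (kron pauli_y (mat 1)) *v conj_vec v)"
proof -
  have "conj_mat (dagger u) = transpose u"
    by (simp add: vec_eq_iff conj_mat_def dagger_def transpose_def)
  then show ?thesis
    by (simp add: rot_op_def T0_def tau_rot_def dagger_kron conj_vec_mult conj_mat_kron
        vector_scalar_commute matrix_vector_mul_assoc kron_mult)
qed

text \<open>The two conjugations cancel, as do the signs from conjugating tau_y and s_y. What
  remains is i tau_y, which u rotates to i tau_z.\<close>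

lemma rot_T0_P0:
  fixes v :: "('x::finite, 'o::finite) bdg_vec"
  assumes "unitary u" "u ** pauli_y ** dagger u = pauli_z"
  shows "rot_op u T0 (rot_op u P0 v) = \<i> *s (kron pauli_z (mat 1) *v v)"
proof -
  have U: "unitary (tau_rot u :: ('x, 'o) bdg_mat)"
    using assms(1) by (rule unitary_tau_rot)
  have n: "- A ** B = - (A ** B)" "A ** - B = - (A ** B)" for A B :: "complex^'n^'n"
    by (simp_all add: vec_eq_iff matrix_matrix_mult_def sum_negf)
  have k: "kron (- A) (kron (- B) C) = kron A (kron B C)" for A :: "complex^'n^'n" and B :: "complex^'m^'m" and C :: "complex^'k^'k"
    by (simp add: vec_eq_iff kron_def)
  have TP: "T0 (P0 w) = \<i> *s (kron pauli_y (mat 1) *v w)" for w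
    by (simp add: T0_def P0_def conj_vec_mult conj_mat_kron conj_mat_pauli_y k
        matrix_vector_mul_assoc kron_mult pauli_y_square kron_mat_1)
  have "rot_op u T0 (rot_op u P0 v) = tau_rot u *v T0 (P0 (dagger (tau_rot u) *v v))"
    using U by (simp add: rot_op_def matrix_vector_mul_assoc unitary_def)
  also have "\<dots> = \<i> *s (kron (u ** pauli_y ** dagger u) (mat 1) *v v)"
    by (simp add: TP vector_scalar_commute matrix_vector_mul_assoc matrix_mul_assoc
        tau_rot_def dagger_kron kron_mult)
  finally show ?thesis
    using assms(2) by simp
qed

text \<open>Comparing entries of u tau_y = tau_z u gives u_11 = i u_12 and u_21 = -i u_22. The
  diagonal of u u^T then cancels and its off-diagonal entry is 2 u_12 u_22. Rows of unit length
  force |u_12|^2 = |u_22|^2 = 1/2, so this entry is a phase and u u^T is tau_x up to that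
  phase.\<close>

lemma rot_square_offdiag:
  assumes "unitary u" "u ** pauli_y ** dagger u = pauli_z"
  obtains a where "norm a = 1" "\<And>b c. (u ** transpose u) $ b $ c = (if b = c then 0 else a)"
proof -
  have "u ** pauli_y = u ** pauli_y ** (dagger u ** u)"
    using assms(1) by (simp add: unitary_def)
  also have "\<dots> = pauli_z ** u"
    using assms(2) by (simp add: matrix_mul_assoc)
  finally have e: "(u ** pauli_y) $ i $ j = (pauli_z ** u) $ i $ j" for i j by simp
  have u1: "u $ 1 $ 1 = \<i> * u $ 1 $ 2"
    using e[of 1 1] by (simp add: matrix_matrix_mult_def sum_2 pauli_y_def pauli_z_def mult.commute)
  have u2: "u $ 2 $ 1 = - \<i> * u $ 2 $ 2"
    using e[of 2 1] by (simp add: matrix_matrix_mult_def sum_2 pauli_y_def pauli_z_def mult.commute equation_minus_iff)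
  have r: "(u ** dagger u) $ i $ i = 1" for i
    using assms(1) by (simp add: unitary_def mat_def)
  have n: "(norm (u $ i $ 1))\<^sup>2 + (norm (u $ i $ 2))\<^sup>2 = 1" for i
  proof -
    have "complex_of_real ((norm (u $ i $ 1))\<^sup>2 + (norm (u $ i $ 2))\<^sup>2) = 1"
      using r[of i] by (simp add: matrix_matrix_mult_def sum_2 dagger_def complex_norm_square flip: of_real_power)
    then show ?thesis by (simp only: of_real_eq_1_iff)
  qed
  have n1: "2 * (norm (u $ 1 $ 2))\<^sup>2 = 1" and n2: "2 * (norm (u $ 2 $ 2))\<^sup>2 = 1"
    using n[of 1] n[of 2] by (simp_all add: u1 u2 norm_mult)
  have "(norm (2 * u $ 1 $ 2 * u $ 2 $ 2))\<^sup>2 = (2 * (norm (u $ 1 $ 2))\<^sup>2) * (2 * (norm (u $ 2 $ 2))\<^sup>2)"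
    by (simp add: norm_mult power_mult_distrib)
  also have "\<dots> = 1"
    by (simp only: n1 n2)
  finally have "norm (2 * u $ 1 $ 2 * u $ 2 $ 2) = 1"
    by (metis norm_ge_zero one_power2 power2_eq_iff_nonneg zero_le_one)
  moreover have "(u ** transpose u) $ b $ c = (if b = c then 0 else 2 * u $ 1 $ 2 * u $ 2 $ 2)" for b c
    using exhaust_2[of b] exhaust_2[of c]
    by (auto simp: matrix_matrix_mult_def transpose_def sum_2 u1 u2 algebra_simps)
  ultimately show thesis by (rule that)
qed

lemma rot_T0_emb:
  assumes "\<And>b c. (u ** transpose u) $ b $ c = (if b = c then 0 else a)"
  shows "rot_op u T0 (emb 1 x) = a *s emb 2 (spin_J x)" "rot_op u T0 (emb 2 x) = a *s emb 1 (spin_J x)"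
  by (simp_all add: rot_op_T0 vec_eq_iff conj_vec_emb kron_emb_nth assms emb_nth spin_J_def forall_2)

lemma rot_T0_add: "rot_op u T0 (v + w) = rot_op u T0 v + rot_op u T0 w"
  by (simp add: rot_op_T0 conj_vec_add matrix_vector_right_distrib vec.scale_right_distrib)

lemma rot_T0_scale: "rot_op u T0 (c *s v) = cnj c *s rot_op u T0 v"
  by (simp add: rot_op_T0 conj_vec_scale vector_scalar_commute vector_smult_assoc mult.commute)

text \<open>Surjectivity makes \<open>inv T\<close> a right inverse, so an intertwining relation
  determines the conjugated operator without computing the inverse.\<close>

lemma conj_op_eq:
  assumes "surj T" "\<And>v. T (A *v v) = B *v T v"
  shows "conj_op T A = (*v) B"
  using assms by (simp add: conj_op_def surj_f_inv_f fun_eq_iff)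

text \<open>Written as nested applications to a vector, so that T can be moved through one factor at
  a time.\<close>

lemma Xi_mult_vec:
  "Xi C M Q *v v = (1/2) *s (M *v (Q *v (dagger M *v (Q *v v))) + C *v (M *v (Q *v (dagger M *v (Q *v v)))))
    + (1/2) *s (dagger M *v (Q *v (M *v (Q *v v))) - C *v (dagger M *v (Q *v (M *v (Q *v v)))))"
proof -
  have s: "(r *\<^sub>R A) *v x = complex_of_real r *s (A *v x)" for r and A :: "complex^'n^'n" and x
    unfolding vec_eq_iff matrix_vector_mult_def
    by (simp add: sum_distrib_left scaleR_conv_of_real[where 'a=complex] mult.assoc)
  show ?thesis
    by (simp add: Xi_def matrix_vector_mult_add_rdistrib matrix_vector_mult_diff_rdistrib s
        flip: matrix_vector_mul_assoc)
qed

section \<open>The Bott index\<close>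

text \<open>\<open>pos_fun\<close> is already diagonal, so the identity matrix serves as the
  diagonalizing unitary.\<close>

lemma phase_mat_eq: "phase_mat f pos = diag (\<lambda>(s, x, a). exp (2 * of_real pi * \<i> * of_real (f (pos x))))"
proof -
  let ?d = "\<lambda>(s, x, a). complex_of_real (f (pos x))"
  have "unitary (mat 1)"
    by (simp add: unitary_def)
  from mat_fun_eq[OF this, of "\<lambda>z. exp (2 * of_real pi * \<i> * z)" ?d] show ?thesis
    by (simp add: phase_mat_def pos_fun_def split_def)
qed

lemma unitary_phase_mat: "unitary (phase_mat f pos)"
proof -
  have "dagger (phase_mat f pos) ** phase_mat f pos = mat 1"
    by (simp add: vec_eq_iff phase_mat_eq diag_mult_right)
      (auto simp: dagger_def diag_def mat_def exp_cnj simp flip: exp_add)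
  then show ?thesis by (simp add: unitary_iff_left)
qed

lemma spin_J_phase_mat:
  "spin_J (phase_mat f pos *v x) = dagger (phase_mat f pos) *v spin_J x"
  using spin_J_diag[of "\<lambda>(x, a). exp (2 * of_real pi * \<i> * of_real (f (pos x)))"]
  by (simp add: phase_mat_eq)

lemma norm_one_notin_nonpos:
  fixes z :: complex
  assumes "norm z = 1" "z \<noteq> - 1"
  shows "z \<notin> \<real>\<^sub>\<le>\<^sub>0"
proof
  assume "z \<in> \<real>\<^sub>\<le>\<^sub>0"
  then obtain r where r: "z = of_real r" "r \<le> 0"
    by (auto simp: nonpos_Reals_def)
  with assms(1) have "r = - 1" by simp
  with r assms(2) show False by simp
qed

text \<open>On the unit circle \<open>Ln\<close> is purely imaginary, and off the branch cut it
  commutes with conjugation. At -1 both terms would be i pi, with sum 2 pi i.\<close>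

lemma Ln_add_Ln_cnj:
  assumes "norm z = 1" "z \<noteq> - 1"
  shows "Ln z + Ln (cnj z) = 0"
proof -
  have "z \<noteq> 0"
    using assms by auto
  then have "Re (Ln z) = 0"
    using assms by simp
  moreover have "Ln z + Ln (cnj z) = Ln z + cnj (Ln z)"
    using cnj_Ln[OF norm_one_notin_nonpos[OF assms]] by simp
  ultimately show ?thesis
    by (simp add: complex_add_cnj)
qed

text \<open>The column of \<open>UB\<close> belonging to a zero singular value is a kernel vector.
  This converts the spectral gap into positivity of the singular values.\<close>

lemma svd_kernel:
  assumes "is_svd h UA \<sigma> UB" "\<sigma> i = 0"
  shows "\<exists>x. x \<noteq> 0 \<and> h *v x = 0"
proof -
  let ?x = "UB *v axis i 1"
  have un: "dagger UB ** UB = mat 1"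
    and h: "h = UA ** diag (\<lambda>i. complex_of_real (\<sigma> i)) ** dagger UB"
    using assms by (auto simp: is_svd_def unitary_def)
  have e: "dagger UB *v ?x = axis i 1"
    by (simp add: matrix_vector_mul_assoc un)
  have "h *v ?x = UA *v (diag (\<lambda>i. complex_of_real (\<sigma> i)) *v (dagger UB *v ?x))"
    by (simp add: h matrix_vector_mul_assoc matrix_mul_assoc)
  also have "\<dots> = UA *v 0"
    unfolding e
    using assms(2)
    by (intro arg_cong[of _ _ "(*v) UA"])
      (auto simp: vec_eq_iff matrix_vector_mult_def diag_def axis_def intro!: sum.neutral)
  finally have "h *v ?x = 0"
    by simp
  moreover have "?x \<noteq> 0"
    using e by (metis axis_eq_0_iff matrix_vector_mult_0_right zero_neq_one)
  ultimately show ?thesis by blast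
qed

theorem mainTheorem1:
  fixes u :: "complex^2^2"
    and H0 H C M Q \<Xi> :: "('x::finite, 'o::finite) bdg_mat"
    and T P :: "('x, 'o) bdg_vec \<Rightarrow> ('x, 'o) bdg_vec"
    and h UA UB q m :: "complex^(2 \<times> 'x \<times> 'o)^(2 \<times> 'x \<times> 'o)"
    and \<sigma> :: "2 \<times> 'x \<times> 'o \<Rightarrow> real"
    and f :: "real^'d \<Rightarrow> real" and pos :: "'x \<Rightarrow> real^'d"
  assumes DIII: "class_DIII H0"
    and u: "unitary u" "u ** pauli_y ** dagger u = pauli_z"
    and H_def: "H = rot_mat u H0"
    and T_def: "T = rot_op u T0" and P_def: "P = rot_op u P0"
    and C_def: "C = chiral T P"
    and H_block: "H = offdiag h (dagger h)"
    and gapped: "\<not> eigenvalue H 0"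
    and svd: "is_svd h UA \<sigma> UB"
    and q_def: "q = UA ** dagger UB"
    and Q_def: "Q = offdiag q (dagger q)"
    and f: "real_polynomial_function f"
    and m_def: "m = phase_mat f pos"
    and M_def: "M = kron (mat 1) m"
    and Xi_def: "\<Xi> = Xi C M Q"
  shows "C = kron pauli_z (mat 1)
    \<and> conj_op T C = (*v) (- C)
    \<and> conj_op T M = (*v) (dagger M)
    \<and> conj_op T Q = (*v) Q
    \<and> conj_op T \<Xi> = (*v) \<Xi>
    \<and> (\<exists>(ev :: 2 \<times> 'x \<times> 'o \<Rightarrow> real) (v :: 2 \<times> 'x \<times> 'o \<Rightarrow> ('x, 'o) bdg_vec).
          orthonormal_basis (\<lambda>(b :: 2, i). if b = 1 then v i else T (v i)) \<and>
          (\<forall>i. \<Xi> *v v i = exp (\<i> * of_real (ev i)) *s v i \<and>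
               \<Xi> *v T (v i) = exp (- \<i> * of_real (ev i)) *s T (v i)))
    \<and> bott_index m q = 1 / (4 * of_real pi * \<i>) * trace (mat_log \<Xi>)
    \<and> (\<not> eigenvalue (m ** q ** dagger m ** dagger q) (- 1) \<longrightarrow> bott_index m q = 0)"
proof -

  \<comment> \<open>T as an antilinear operator on the two blocks\<close>
  note T = T_def
  obtain a where a: "norm a = 1" and sq: "\<And>b c. (u ** transpose u) $ b $ c = (if b = c then 0 else a)"
    using rot_square_offdiag[OF u] by blast
  have T_emb: "T (emb 1 x) = a *s emb 2 (spin_J x)" "T (emb 2 x) = a *s emb 1 (spin_J x)" for x
    unfolding T by (simp_all only: rot_T0_emb[OF sq])
  have T_add: "T (v + w) = T v + T w" and T_scale: "T (c *s v) = cnj c *s T v" for v w c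
    unfolding T by (simp_all only: rot_T0_add rot_T0_scale)
  have T_minus: "T (- v) = - T v" for v
    using T_scale[of "- 1" v] by simp
  have T_diff: "T (v - w) = T v - T w" for v w
    using T_add[of v "- w"] by (simp add: T_minus)
  have "cnj a * a = 1"
    using a complex_norm_square[of a] by (simp add: mult.commute)
  have TT: "T (T v) = - v" for v
  proof -
    obtain x y where "v = emb 1 x + emb 2 y"
      by (rule emb_decomp)
    moreover have "emb b (- x) = - emb b x" for b and x :: "complex^(2 \<times> 'x \<times> 'o)"
      by (simp add: vec_eq_iff emb_nth)
    ultimately show ?thesis
      by (simp add: T_add T_emb T_scale vector_smult_assoc \<open>cnj a * a = 1\<close> spin_J_spin_J)
  qed
  \<comment> \<open>Since T^2 = -1, the map -T is a right inverse of T.\<close>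
  have "surj T"
  proof (rule surjI)
    show "T (- T v) = v" for v by (simp add: T_minus TT)
  qed
  note conj_T = conj_op_eq[OF this]
  have intertwine: "T (A *v v) = B *v T v"
    if "\<And>x. T (A *v emb 1 x) = B *v T (emb 1 x)" "\<And>x. T (A *v emb 2 x) = B *v T (emb 2 x)" for A B v
  proof -
    obtain x y where "v = emb 1 x + emb 2 y"
      by (rule emb_decomp)
    with that show ?thesis
      by (simp add: T_add matrix_vector_right_distrib)
  qed

  \<comment> \<open>Symmetry of h and of its unitary factor\<close>
  have TH: "T (H *v v) = H *v T v" for v
  proof -
    let ?U = "tau_rot u :: ('x, 'o) bdg_mat"
    have "unitary ?U"
      using u(1) by (rule unitary_tau_rot)
    then have U: "dagger ?U ** ?U = mat 1"
      by (simp add: unitary_def)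
    have "dagger ?U *v (H *v v) = (dagger ?U ** ?U) *v (H0 *v (dagger ?U *v v))"
      by (simp only: H_def rot_mat_def matrix_vector_mul_assoc matrix_mul_assoc)
    then have "T (H *v v) = ?U *v (H0 *v T0 (dagger ?U *v v))"
      using DIII by (simp add: U T rot_op_def class_DIII_def)
    also have "\<dots> = ?U *v (H0 *v ((dagger ?U ** ?U) *v T0 (dagger ?U *v v)))"
      by (simp add: U)
    also have "\<dots> = H *v T v"
      by (simp only: T H_def rot_mat_def rot_op_def matrix_vector_mul_assoc matrix_mul_assoc)
    finally show ?thesis .
  qed
  \<comment> \<open>Evaluating T H = H T on each block gives one relation for h and one for its
    adjoint, once the common factor a is cancelled.\<close>
  have "a \<noteq> 0"
    using a by auto
  then have J_h: "\<forall>x. spin_J (h *v x) = dagger h *v spin_J x"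
    "\<forall>x. spin_J (dagger h *v x) = h *v spin_J x"
    using TH[of "emb 2 _"] TH[of "emb 1 _"]
    by (simp_all add: H_block offdiag_emb T_emb vector_scalar_commute)

  \<comment> \<open>A kernel vector of h, placed in the second block, would be a zero mode of
    H.\<close>
  have "\<sigma> i \<noteq> 0" for i
  proof
    assume "\<sigma> i = 0"
    then obtain x where x: "x \<noteq> 0" "h *v x = 0"
      using svd_kernel[OF svd] by blast
    have "emb 2 x \<noteq> 0"
      using x(1) emb_eq_iff[of 2 x 0] by simp
    moreover have "H *v emb 2 x = 0 *s emb 2 x"
      using x(2) by (simp add: H_block offdiag_emb)
    ultimately show False
      using gapped by (auto simp: eigenvalue_def)
  qed
  then have pos: "\<sigma> i > 0" for i
    using svd unfolding is_svd_def by (metis order_less_le)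
  note J_q = spin_J_polar_factor[OF svd pos J_h, folded q_def]
  have J_m: "spin_J (m *v x) = dagger m *v spin_J x" for x
    unfolding m_def by (rule spin_J_phase_mat)

  \<comment> \<open>Conjugation of C, M, Q and Xi by T\<close>
  have "rot_op u T0 (rot_op u P0 v) = \<i> *s (kron pauli_z (mat 1) *v v)" for v :: "('x, 'o) bdg_vec"
    by (rule rot_T0_P0[OF u])
  then have C_eq: "C = kron pauli_z (mat 1)"
    by (simp add: C_def chiral_def T_def P_def vector_smult_assoc)
  have dM: "dagger M = kron (mat 1) (dagger m)"
    by (simp add: M_def dagger_kron)
  have C_emb: "C *v emb 1 x = emb 1 x" "C *v emb 2 x = - emb 2 x" for x
    by (simp_all add: C_eq pauli_z_emb)
  have M_emb: "M *v emb b x = emb b (m *v x)" "dagger M *v emb b x = emb b (dagger m *v x)" for b x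
    unfolding dM unfolding M_def by (rule kron_one_emb)+
  have Q_emb: "Q *v emb 1 x = emb 2 (dagger q *v x)" "Q *v emb 2 x = emb 1 (q *v x)" for x
    by (simp_all add: Q_def offdiag_emb)
  have TC: "T (C *v v) = - C *v T v" for v
    by (rule intertwine)
      (simp_all add: C_emb T_emb T_minus vector_scalar_commute matrix_vector_mult_minus)
  \<comment> \<open>Evaluate \<open>J_m\<close> at J x, apply J once more and use J^2 = -1.\<close>
  have J_dm: "spin_J (dagger m *v x) = m *v spin_J x" for x
    using arg_cong[OF J_m[of "spin_J x"], of spin_J]
    by (simp add: spin_J_spin_J spin_J_minus matrix_vector_mult_minus)
  have TM: "T (M *v v) = dagger M *v T v" for v
    by (rule intertwine) (simp_all add: M_emb T_emb vector_scalar_commute J_m)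
  have TdM: "T (dagger M *v v) = M *v T v" for v
    by (rule intertwine) (simp_all add: M_emb T_emb vector_scalar_commute J_dm)
  have TQ: "T (Q *v v) = Q *v T v" for v
    by (rule intertwine) (simp_all add: Q_emb T_emb vector_scalar_commute J_q)
  \<comment> \<open>T anticommutes with C, so it swaps the projectors (1 + C)/2 and (1 - C)/2; it
    also swaps M with its adjoint. The two summands of Xi are therefore exchanged.\<close>
  have T\<Xi>: "T (\<Xi> *v v) = \<Xi> *v T v" for v
    by (simp add: Xi_def Xi_mult_vec T_add T_diff T_scale TM TdM TQ TC
        matrix_vector_mult_minus add.commute)

  \<comment> \<open>Block form of Xi and its time-reversal pairs of eigenvectors\<close>
  define A where "A = m ** q ** dagger m ** dagger q"
  define B where "B = dagger m ** dagger q ** m ** q"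
  \<comment> \<open>Both products apply Q twice and hence preserve each block; on each block the
    projectors keep just one of them.\<close>
  have \<Xi>_emb: "\<Xi> *v emb 1 x = emb 1 (A *v x)" "\<Xi> *v emb 2 x = emb 2 (B *v x)" for x
  proof -
    have "(1/2) *s (2 * v) = v" for v :: "('x, 'o) bdg_vec"
      by (simp add: vec_eq_iff)
    then show "\<Xi> *v emb 1 x = emb 1 (A *v x)" "\<Xi> *v emb 2 x = emb 2 (B *v x)"
      by (simp_all add: Xi_def Xi_mult_vec Q_emb M_emb C_emb A_def B_def
          flip: matrix_vector_mul_assoc)
  qed
  have um: "unitary m"
    unfolding m_def by (rule unitary_phase_mat)
  have uq: "unitary q"
    using svd unfolding q_def is_svd_def by (intro unitary_mult unitary_dagger) auto
  have "unitary A"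
    unfolding A_def by (intro unitary_mult unitary_dagger um uq)
  then obtain w d where w: "orthonormal_basis w"
    and wd: "\<forall>i. A *v w i = d i *s w i \<and> norm (d i) = 1"
    using unitary_diagonalizable by blast
  have ev: "A *v w i = d i *s w i" and nd: "norm (d i) = 1" for i
    using wd by blast+
  define v where "v i = (emb 1 (w i) :: ('x, 'o) bdg_vec)" for i
  have \<Xi>_v: "\<Xi> *v v i = d i *s v i" for i
    by (simp add: v_def \<Xi>_emb ev emb_scale)
  \<comment> \<open>T commutes with Xi but is antilinear, so the eigenvalue is conjugated.\<close>
  have \<Xi>_Tv: "\<Xi> *v T (v i) = cnj (d i) *s T (v i)" for i
    by (simp add: \<Xi>_v T_scale flip: T\<Xi>)

  have d_exp: "d i = exp (\<i> * of_real (Arg (d i)))" for i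
  proof -
    have "d i \<noteq> 0"
      using nd[of i] by auto
    from Arg_eq[OF this] show ?thesis
      unfolding nd of_real_1 mult_1 .
  qed
  have cd_exp: "cnj (d i) = exp (- \<i> * of_real (Arg (d i)))" for i
  proof -
    have "cnj (d i) = cnj (exp (\<i> * of_real (Arg (d i))))"
      using d_exp by (rule arg_cong)
    also have "\<dots> = exp (- \<i> * of_real (Arg (d i)))"
      by (simp add: exp_cnj)
    finally show ?thesis .
  qed

  \<comment> \<open>J reverses inner products and a is a phase, so T carries the basis of the first
    block to an orthonormal basis of the second.\<close>
  have "cinner (a *s spin_J x) (a *s spin_J y) = (cnj a * a) * cinner y x" for x y :: "complex^(2 \<times> 'x \<times> 'o)"
    by (simp add: cinner_scale_left cinner_scale_right cinner_spin_J)
  then have "orthonormal_basis (\<lambda>i. a *s spin_J (w i))"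
    using w by (auto simp: orthonormal_basis_iff \<open>cnj a * a = 1\<close>)
  from orthonormal_basis_emb[OF w this]
  have onT: "orthonormal_basis (\<lambda>(b :: 2, i). if b = 1 then v i else T (v i))"
    unfolding v_def T_emb emb_scale .

  \<comment> \<open>The trace of log Xi in two eigenbases\<close>
  have trA: "trace (mat_log A) = (\<Sum>i\<in>UNIV. Ln (d i))"
    unfolding mat_log_def by (rule trace_mat_fun[OF w ev])

  text \<open>\<open>B\<close> is conjugate to \<open>A\<close> by \<open>q m\<close>, so both blocks of \<open>\<Xi>\<close> have the spectrum of \<open>A\<close>.\<close>
  let ?X = "dagger m ** dagger q"
  have uX: "unitary ?X"
    by (intro unitary_mult unitary_dagger um uq)
  have "B ** ?X = ?X ** A"
  proof -
    have "?X ** A = dagger m ** (dagger q ** m ** q ** dagger m ** dagger q)"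
      by (simp only: A_def matrix_mul_assoc)
    also have "\<dots> = B ** ?X"
      by (simp only: B_def matrix_mul_assoc)
    finally show ?thesis by simp
  qed
  then have evB: "B *v (?X *v w i) = d i *s (?X *v w i)" for i
    by (simp add: matrix_vector_mul_assoc) (simp add: ev vector_scalar_commute flip: matrix_vector_mul_assoc)
  have tr1: "trace (mat_log \<Xi>) = (\<Sum>(b :: 2, i)\<in>UNIV. Ln (d i))"
    unfolding mat_log_def case_prod_beta
    by (rule trace_mat_fun[OF orthonormal_basis_emb[OF w orthonormal_basis_unitary[OF w uX]]])
      (auto simp: \<Xi>_emb ev evB emb_scale)
  \<comment> \<open>The trace from \<open>tr1\<close>, evaluated now in the basis of time-reversal
    pairs; this is where T constrains the index.\<close>
  have tr2: "trace (mat_log \<Xi>) = (\<Sum>(b :: 2, i)\<in>UNIV. Ln (if b = 1 then d i else cnj (d i)))"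
    unfolding mat_log_def case_prod_beta
    by (rule trace_mat_fun[OF onT]) (auto simp: \<Xi>_v \<Xi>_Tv)
  have tr\<Xi>: "trace (mat_log \<Xi>) = 2 * trace (mat_log A)"
    by (simp add: tr1 trA sum_2_prod)
  have bott: "bott_index m q = 1 / (4 * of_real pi * \<i>) * trace (mat_log \<Xi>)"
    by (simp add: bott_index_def tr\<Xi> flip: A_def)
  have zero: "bott_index m q = 0" if "\<not> eigenvalue A (- 1)"
  proof -
    \<comment> \<open>Excluding the eigenvalue -1 keeps every d i off the branch cut, as the
      cancellation in each pair requires.\<close>
    have "d i \<noteq> - 1" for i
    proof
      assume "d i = - 1"
      then have "A *v w i = - 1 *s w i"
        using ev[of i] by simp
      then show False
        using that orthonormal_basis_nonzero[OF w, of i] by (auto simp: eigenvalue_def)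
    qed
    then have "(\<Sum>i\<in>UNIV. Ln (d i) + Ln (cnj (d i))) = 0"
      by (simp add: Ln_add_Ln_cnj nd)
    moreover have "trace (mat_log \<Xi>) = (\<Sum>i\<in>UNIV. Ln (d i)) + (\<Sum>i\<in>UNIV. Ln (cnj (d i)))"
      unfolding tr2 by (subst sum_2_prod) simp
    ultimately show ?thesis
      by (simp only: bott sum.distrib) simp
  qed

  show ?thesis
  proof (intro conjI)
    show "\<exists>(ev :: 2 \<times> 'x \<times> 'o \<Rightarrow> real) (v :: 2 \<times> 'x \<times> 'o \<Rightarrow> ('x, 'o) bdg_vec).
          orthonormal_basis (\<lambda>(b :: 2, i). if b = 1 then v i else T (v i)) \<and>
          (\<forall>i. \<Xi> *v v i = exp (\<i> * of_real (ev i)) *s v i \<and>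
               \<Xi> *v T (v i) = exp (- \<i> * of_real (ev i)) *s T (v i))"
      using onT \<Xi>_v \<Xi>_Tv
      by (intro exI[of _ "\<lambda>i. Arg (d i)"] exI[of _ v]) (simp only: d_exp[symmetric] cd_exp[symmetric] simp_thms)
    show "\<not> eigenvalue (m ** q ** dagger m ** dagger q) (- 1) \<longrightarrow> bott_index m q = 0"
      using zero by (simp add: A_def)
  qed (fact C_eq bott conj_T[OF TC] conj_T[OF TM] conj_T[OF TQ] conj_T[OF T\<Xi>])+
qed

end
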